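(* Let $\beta,\gamma>0$ be real numbers and let $p$ be analytic in $\mathbb{D}$ with $p(0)=1$. If $$p^2(z)+\frac{zp'(z)}{\beta p(z)+\gamma}\prec 1+z,$$ then $p(z)\prec\sqrt{1+z}$.
   Context: $\mathbb{D}=\{z\in\mathbb{C}:|z|<1\}$; $p^k(z)=(p(z))^k$. For analytic $f,g$ on $\mathbb{D}$, $f\prec g$ ($f$ is subordinate to $g$) means there is an analytic $w:\mathbb{D}\to\mathbb{D}$ with $w(0)=0$ and $f(z)=g(w(z))$ for all $z\in\mathbb{D}$; in particular the left-hand side of a subordination is understood to be an analytic function on $\mathbb{D}$. $\sqrt{1+z}$ is the principal branch; it maps $\mathbb{D}$ univalently onto $\{w:|w^2-1|<1,\ \operatorname{Re}w>0\}$. *)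

theory Defs
  imports "HOL-Complex_Analysis.Complex_Analysis"
begin

abbreviation unit_disc :: "complex set"  (\<open>\<D>\<close>)
  where "\<D> \<equiv> ball 0 1"

text \<open>
  Analyticity of both sides is part of the relation. For a left-hand side containing a quotient,
  this interacts with the convention \<open>x / 0 = 0\<close>: in \<open>z * deriv p z / (\<beta> * p z + \<gamma>)\<close>, with
  \<open>p\<close> analytic and \<open>\<beta> * p 0 + \<gamma> \<noteq> 0\<close>, any zero of the denominator is a pole of the quotient and
  so destroys continuity, whatever value is assigned there. Hence the subordination itself forces
  the denominator to be nonzero on the disc.
\<close>

definition subordinate :: "(complex \<Rightarrow> complex) \<Rightarrow> (complex \<Rightarrow> complex) \<Rightarrow> bool"
    (infix \<open>\<prec>\<close> 50)
  where "f \<prec> g \<longleftrightarrow> f holomorphic_on \<D> \<and> g holomorphic_on \<D> \<and>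
    (\<exists>w. w holomorphic_on \<D> \<and> w \<in> \<D> \<rightarrow> \<D> \<and> w 0 = 0 \<and> (\<forall>z\<in>\<D>. f z = g (w z)))"

end

theory Submission
  imports Defs
begin

text \<open>
  Put \<open>w = p\<^sup>2 - 1\<close>. If \<open>\<bar>w\<bar> < 1\<close> fails on the disc, let \<open>z\<^sub>0\<close> be a point of least modulus with
  \<open>\<bar>w z\<^sub>0\<bar> \<ge> 1\<close>. By Jack's lemma \<open>z\<^sub>0 w' z\<^sub>0 = m w z\<^sub>0\<close> with \<open>m \<ge> 1\<close>, where \<open>w' = 2 p p'\<close>; in particular
  \<open>p z\<^sub>0 \<noteq> 0\<close>, and the left-hand side of the subordination minus 1 equals
  \<open>w z\<^sub>0 (1 + m / (2 q))\<close> with \<open>q = p z\<^sub>0 (\<beta> p z\<^sub>0 + \<gamma>)\<close>. Here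
  \<open>Re q = \<beta> (1 + Re (w z\<^sub>0)) + \<gamma> Re (p z\<^sub>0) \<ge> 0\<close>, because \<open>Re p\<close> has no zero where \<open>\<bar>w\<bar> < 1\<close>
  and so stays positive for \<open>\<bar>z\<bar> < \<bar>z\<^sub>0\<bar>\<close>. Hence the left-hand side minus 1 has modulus at least 1
  at \<open>z\<^sub>0\<close>, which is impossible.
\<close>

text \<open>The rescaled map \<open>h\<close> sends the unit disc into itself with
  \<open>h 0 = 0\<close> and \<open>h 1 = 1\<close>, and \<open>D\<close> is its derivative at 1.
  Schwarz's lemma along the radius gives \<open>Re D \<ge> 1\<close>; maximality of
  \<open>Re h\<close> at 1 along the unit circle gives \<open>Im D = 0\<close>. So
  \<open>m = Re D\<close> works.\<close>

lemma Jack_lemma: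
  fixes w :: "complex \<Rightarrow> complex"
  assumes holo: "w holomorphic_on A" and A: "open A" "cball 0 (norm z0) \<subseteq> A"
    and w0: "w 0 = 0" and nz: "w z0 \<noteq> 0"
    and less: "\<And>z. norm z < norm z0 \<Longrightarrow> norm (w z) < norm (w z0)"
  obtains m :: real where "m \<ge> 1" and "z0 * deriv w z0 = of_real m * w z0"
proof -
  define h where "h = (\<lambda>z. w (z0 * z) / w z0)"
  define D where "D = z0 * deriv w z0 / w z0"
  have z0: "z0 \<noteq> 0"
    using w0 nz by auto
  have le: "norm (w z) \<le> norm (w z0)" if "norm z \<le> norm z0" for z
  proof (rule continuous_le_on_closure[where S = "ball 0 (norm z0)" and f = "\<lambda>z. norm (w z)"])
    show "continuous_on (closure (ball 0 (norm z0))) (\<lambda>z. norm (w z))"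
      using holo A z0
      by (auto intro!: continuous_intros holomorphic_on_imp_continuous_on
          intro: holomorphic_on_subset)
  qed (use that less z0 in \<open>auto simp: less_imp_le\<close>)
  have h1: "h 1 = 1"
    using nz by (simp add: h_def)
  have h_le: "norm (h z) \<le> 1" if "norm z = 1" for z
    using le[of "z0 * z"] that nz by (simp add: h_def norm_mult norm_divide)
  have holh: "h holomorphic_on ball 0 1"
  proof -
    have "(\<lambda>z. w (z0 * z)) holomorphic_on ball 0 1"
      by (rule holomorphic_on_compose_gen[OF _ holo, of "\<lambda>z. z0 * z", unfolded o_def])
        (use A in \<open>auto intro!: holomorphic_intros subsetD[OF A(2)]
          simp: norm_mult mult_left_le less_imp_le\<close>)
    then show ?thesis
      unfolding h_def using nz by (intro holomorphic_intros) auto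
  qed
  have h_less: "norm (h z) < 1" if "norm z < 1" for z
    using less[of "z0 * z"] that nz z0 by (simp add: h_def norm_mult norm_divide)
  have schwarz: "norm (h z) \<le> norm z" if "norm z < 1" for z
    by (rule Schwarz_Lemma(1)[OF holh _ h_less that]) (simp add: h_def w0)
  have dw: "(w has_field_derivative deriv w z0) (at z0)"
    using holo A by (intro holomorphic_derivI) auto
  have dh: "(h has_field_derivative D) (at 1)"
  proof -
    have "((\<lambda>z. w (z0 * z)) has_field_derivative deriv w z0 * z0) (at 1)"
      by (rule DERIV_chain2[where f = w]) (auto intro!: derivative_eq_intros simp: dw)
    from DERIV_cdivide[OF this] show ?thesis
      by (simp add: h_def D_def mult.commute)
  qed
  have radial: "((\<lambda>t. Re (h (of_real t)) - t) has_real_derivative Re D - 1) (at 1)"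
  proof -
    have "((\<lambda>t. h (of_real t)) has_vector_derivative D) (at (1::real))"
      using has_vector_derivative_real_field[of h D 1 UNIV] dh by simp
    then show ?thesis
      by (intro derivative_intros)
  qed
  \<comment> \<open>By Schwarz, \<open>Re (h t) - t\<close> is at most 0 for
    \<open>0 < t < 1\<close>, and it vanishes at \<open>t = 1\<close>, so its derivative there
    cannot be negative.\<close>
  have "Re D \<ge> 1"
  proof (rule ccontr)
    assume "\<not> Re D \<ge> 1"
    then obtain d where d: "d > 0"
      "\<And>s. s > 0 \<Longrightarrow> s < d \<Longrightarrow> Re (h (of_real 1)) - 1 < Re (h (of_real (1 - s))) - (1 - s)"
      using DERIV_neg_dec_left[OF radial] by auto
    define s where "s = min (1/2) (d/2)"
    have s: "0 < s" "s < 1" "s < d"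
      using d(1) by (auto simp: s_def)
    have "Re (h (of_real (1 - s))) \<le> 1 - s"
      using complex_Re_le_cmod[of "h (of_real (1 - s))"] schwarz[of "of_real (1 - s)"] s
      unfolding norm_of_real by linarith
    with d(2)[OF s(1,3)] show False
      by (simp add: h1)
  qed
  \<comment> \<open>Tangential direction: \<open>Re (h (cis t))\<close> is maximal at
    \<open>t = 0\<close>, and its derivative there is \<open>Re (\<i> * D) = - Im D\<close>.\<close>
  have "((\<lambda>t. h (cis t)) has_vector_derivative \<i> * D) (at (0::real))"
  proof -
    have "(cis has_vector_derivative \<i>) (at 0)"
      using has_derivative_cis[of "\<lambda>x. x" "\<lambda>x. x" 0 UNIV] by (simp add: has_vector_derivative_def)
    from field_vector_diff_chain_at[OF this, of h D] dh show ?thesis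
      by (simp add: o_def)
  qed
  then have "((\<lambda>t. Re (h (cis t))) has_real_derivative Re (\<i> * D)) (at 0)"
    by (intro derivative_intros)
  moreover have "Re (h (cis t)) \<le> Re (h (cis 0))" for t
    using complex_Re_le_cmod[of "h (cis t)"] h_le[of "cis t"] by (simp add: h1)
  ultimately have "Re (\<i> * D) = 0"
    using DERIV_local_max[of "\<lambda>t. Re (h (cis t))" _ 0 1] zero_less_one by blast
  then have "D = of_real (Re D)"
    by (simp add: complex_eq_iff)
  then have "z0 * deriv w z0 = of_real (Re D) * w z0"
    using nz unfolding D_def by (metis nonzero_eq_divide_eq)
  with \<open>Re D \<ge> 1\<close> show thesis
    by (rule that)
qed

text \<open>On the imaginary axis the square is real and at most 0, hence at distance at least 1
  from 1. So \<open>Re p\<close> cannot vanish on \<open>S\<close>, and by connectedness it keeps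
  its sign.\<close>

lemma Re_pos_of_square_near_1:
  fixes p :: "complex \<Rightarrow> complex"
  assumes S: "connected S" "a \<in> S" "b \<in> S" and p: "continuous_on S p"
    and a: "Re (p a) > 0" and near: "\<And>z. z \<in> S \<Longrightarrow> norm (p z ^ 2 - 1) < 1"
  shows "Re (p b) > 0"
proof (rule ccontr)
  assume "\<not> Re (p b) > 0"
  have "connected ((\<lambda>z. Re (p z)) ` S)"
    using S p by (intro connected_continuous_image continuous_intros)
  then have "0 \<in> (\<lambda>z. Re (p z)) ` S"
    using connectedD_interval[of _ "Re (p b)" "Re (p a)" 0] S a \<open>\<not> Re (p b) > 0\<close> by auto
  then obtain z where z: "z \<in> S" "Re (p z) = 0"
    by auto
  have "Re (p z ^ 2 - 1) \<le> - 1"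
    using z by (simp add: power2_eq_square)
  with near[OF z(1)] abs_Re_le_cmod[of "p z ^ 2 - 1"] show False
    by linarith
qed

lemma norm_one_plus_divide_ge_1:
  assumes "m \<ge> 0" and "Re q \<ge> 0"
  shows "norm (1 + of_real m / q) \<ge> 1"
proof -
  have "Re (of_real m / q) \<ge> 0"
    using assms by (simp add: Re_divide)
  with complex_Re_le_cmod[of "1 + of_real m / q"] show ?thesis
    by simp
qed

lemma square_near_1:
  fixes \<beta> \<gamma> :: real and p :: "complex \<Rightarrow> complex"
  assumes pos: "\<beta> \<ge> 0" "\<gamma> \<ge> 0"
    and holo: "p holomorphic_on \<D>" and p0: "p 0 = 1"
    and near: "\<And>z. z \<in> \<D> \<Longrightarrow>
      norm (p z ^ 2 + z * deriv p z / (of_real \<beta> * p z + of_real \<gamma>) - 1) < 1"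
    and b: "b \<in> \<D>"
  shows "norm (p b ^ 2 - 1) < 1"
proof (rule ccontr)
  assume nb: "\<not> norm (p b ^ 2 - 1) < 1"
  define w where "w = (\<lambda>z. p z ^ 2 - 1)"
  have holw: "w holomorphic_on \<D>"
    unfolding w_def by (intro holomorphic_intros holo)
  have contp: "continuous_on \<D> p" and contw: "continuous_on \<D> w"
    using holo holw by (auto intro: holomorphic_on_imp_continuous_on)
  \<comment> \<open>Restricting to the closed disc of radius \<open>norm b\<close> makes
    \<open>K\<close> closed in the plane, so it has a point nearest to 0.\<close>
  define K where "K = cball 0 (norm b) \<inter> {z. norm (w z) \<ge> 1}"
  have sub: "cball 0 (norm b) \<subseteq> \<D>"
    using b by auto
  have "closed ({z \<in> cball 0 (norm b). 1 \<le> norm (w z)})"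
    by (intro continuous_on_closed_Collect_le continuous_intros continuous_on_subset[OF contw sub])
      auto
  then have "closed K"
    by (simp add: K_def Int_def)
  moreover have "b \<in> K"
    using nb by (simp add: K_def w_def)
  ultimately obtain z0 where z0K: "z0 \<in> K" and min: "\<And>y. y \<in> K \<Longrightarrow> norm z0 \<le> norm y"
    using distance_attains_inf[of K 0] by auto
  have z0b: "norm z0 \<le> norm b" and wge: "norm (w z0) \<ge> 1"
    using z0K by (auto simp: K_def)
  have z0D: "z0 \<in> \<D>"
    using z0b b by simp
  have w0: "w 0 = 0"
    by (simp add: w_def p0)
  have wz0: "w z0 \<noteq> 0"
    using wge by auto
  then have z0: "z0 \<noteq> 0"
    using w0 by auto
  have less: "norm (w z) < 1" if "norm z < norm z0" for z
    using min[of z] that z0b by (force simp: K_def)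
  have subc: "closure (ball 0 (norm z0)) \<subseteq> \<D>"
    using z0D z0 by auto
  have in_closure: "z0 \<in> closure (ball 0 (norm z0))"
    using z0 by simp
  have "norm (w z0) \<le> 1"
  proof (rule continuous_le_on_closure[OF _ in_closure, where f = "\<lambda>z. norm (w z)"])
    show "continuous_on (closure (ball 0 (norm z0))) (\<lambda>z. norm (w z))"
      by (intro continuous_intros continuous_on_subset[OF contw subc])
  qed (use less in \<open>simp add: less_imp_le\<close>)
  with wge have w1: "norm (w z0) = 1"
    by simp
  have Rep: "Re (p z0) \<ge> 0"
  proof (rule continuous_ge_on_closure[OF _ in_closure, where f = "\<lambda>z. Re (p z)"])
    show "continuous_on (closure (ball 0 (norm z0))) (\<lambda>z. Re (p z))"
      by (intro continuous_intros continuous_on_subset[OF contp subc])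
    show "Re (p z) \<ge> 0" if "z \<in> ball 0 (norm z0)" for z
    proof -
      have "Re (p z) > 0"
      proof (rule Re_pos_of_square_near_1[where S = "ball 0 (norm z0)" and a = 0 and p = p])
        show "continuous_on (ball 0 (norm z0)) p"
          using z0D by (intro continuous_on_subset[OF contp]) auto
        show "norm (p y ^ 2 - 1) < 1" if "y \<in> ball 0 (norm z0)" for y
          using less[of y] that by (simp add: w_def)
      qed (use that z0 p0 in simp_all)
      then show ?thesis
        by simp
    qed
  qed
  obtain m :: real where m: "m \<ge> 1" "z0 * deriv w z0 = of_real m * w z0"
    using Jack_lemma[of w \<D> z0] holw z0D w0 wz0 less w1 by (auto simp: subset_iff)
  have "(p has_field_derivative deriv p z0) (at z0)"
    using holo z0D by (intro holomorphic_derivI) auto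
  then have "(w has_field_derivative 2 * p z0 * deriv p z0) (at z0)"
    unfolding w_def by (auto intro!: derivative_eq_intros)
  then have "deriv w z0 = 2 * p z0 * deriv p z0"
    by (rule DERIV_imp_deriv)
  with m have eq: "2 * p z0 * (z0 * deriv p z0) = of_real m * w z0"
    by (simp add: mult_ac)
  have pz0: "p z0 \<noteq> 0"
    using eq m wz0 by auto
  define d where "d = of_real \<beta> * p z0 + of_real \<gamma>"
  have "Re (p z0 * d) = \<beta> * Re (p z0 ^ 2) + \<gamma> * Re (p z0)"
    by (simp add: d_def power2_eq_square algebra_simps)
  \<comment> \<open>\<open>Re (p z0 ^ 2) = 1 + Re (w z0)\<close>, and
    \<open>norm (w z0) = 1\<close>.\<close>
  moreover have "Re (p z0 ^ 2) \<ge> 0"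
    using abs_Re_le_cmod[of "w z0"] w1 by (simp add: w_def)
  ultimately have "Re (2 * (p z0 * d)) \<ge> 0"
    using pos Rep by simp
  then have "norm (1 + of_real m / (2 * (p z0 * d))) \<ge> 1"
    using m by (intro norm_one_plus_divide_ge_1) auto
  \<comment> \<open>If \<open>d = 0\<close>, both quotients with \<open>d\<close> are 0 by
    convention and the two sides are just \<open>w z0\<close>.\<close>
  moreover have "p z0 ^ 2 + z0 * deriv p z0 / d - 1 = w z0 * (1 + of_real m / (2 * (p z0 * d)))"
  proof -
    have "z0 * deriv p z0 = of_real m * w z0 / (2 * p z0)"
      using eq pz0 by (simp add: field_simps)
    then show ?thesis
      by (simp add: w_def algebra_simps)
  qed
  ultimately have "norm (p z0 ^ 2 + z0 * deriv p z0 / d - 1) \<ge> 1"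
    by (simp add: norm_mult w1)
  with near[OF z0D] show False
    by (simp add: d_def)
qed

theorem lemma3p4:
  fixes \<beta> \<gamma> :: real and p :: "complex \<Rightarrow> complex"
  assumes "\<beta> > 0" and "\<gamma> > 0"
    and "p holomorphic_on \<D>" and "p 0 = 1"
    and "(\<lambda>z. p z ^ 2 + z * deriv p z / (of_real \<beta> * p z + of_real \<gamma>)) \<prec> (\<lambda>z. 1 + z)"
  shows "p \<prec> (\<lambda>z. csqrt (1 + z))"
proof -
  have "norm (p z ^ 2 + z * deriv p z / (of_real \<beta> * p z + of_real \<gamma>) - 1) < 1" if "z \<in> \<D>" for z
    using assms(5) that unfolding subordinate_def by (fastforce simp: Pi_iff)
  then have near: "norm (p z ^ 2 - 1) < 1" if "z \<in> \<D>" for z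
    using square_near_1[of \<beta> \<gamma> p] assms(1-4) that by simp
  have "Re (p z) > 0" if "z \<in> \<D>" for z
    using Re_pos_of_square_near_1[of \<D> 0 z p] near that assms(3,4)
    by (simp add: holomorphic_on_imp_continuous_on)
  \<comment> \<open>The principal root inverts squaring on the right half-plane, so
    \<open>p z ^ 2 - 1\<close> is the witness for the subordination.\<close>
  then have sqrt: "p z = csqrt (1 + (p z ^ 2 - 1))" if "z \<in> \<D>" for z
    using that by (simp add: csqrt_square)
  \<comment> \<open>\<open>1 + z\<close> has positive real part and so avoids the branch cut of
    \<open>csqrt\<close>.\<close>
  have "1 + z \<notin> \<real>\<^sub>\<le>\<^sub>0" if "z \<in> \<D>" for z :: complex
    using that abs_Re_le_cmod[of z] by (auto simp: complex_nonpos_Reals_iff)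
  then have "(\<lambda>z. csqrt (1 + z)) holomorphic_on \<D>"
    by (intro holomorphic_intros)
  moreover have "(\<lambda>z. p z ^ 2 - 1) holomorphic_on \<D>"
    by (intro holomorphic_intros assms(3))
  ultimately show ?thesis
    unfolding subordinate_def using assms(3,4) near sqrt
    by (intro conjI exI[of _ "\<lambda>z. p z ^ 2 - 1"]) auto
qed

end
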